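(* Let $\mathcal A$ be a standard operator algebra on a Banach space of dimension greater than $1$, and let $\mathcal R$ be an arbitrary ring. Suppose that $M\colon\mathcal A\to\mathcal R$ and $M^*\colon\mathcal R\to\mathcal A$ are surjective maps (not assumed additive) such that $M(aM^*(x)+M^*(x)a)=M(a)x+xM(a)$ and $M^*(M(a)x+xM(a))=aM^*(x)+M^*(x)a$ for all $a\in\mathcal A$, $x\in\mathcal R$. Then both $M$ and $M^*$ are additive.
   Context: Rings are associative and need not have an identity element. For a (real or complex) Banach space $X$, $B(X)$ is the algebra of all bounded linear operators on $X$. A standard operator algebra on $X$ is a subalgebra of $B(X)$ that contains all finite rank operators in $B(X)$; it is not assumed closed or unital. *)

theory Defs
  imports "HOL-Analysis.Analysis"
begin

(* The scalar field: up to isometric isomorphism, either the reals or the complex numbers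
   (multiplicativity of the norm forces it to be the usual absolute value). *)
class real_or_complex = real_normed_field +
  assumes real_or_complex:
    "(\<forall>z. \<exists>a. z = a *\<^sub>R 1) \<or>
     (\<exists>i. i * i = - 1 \<and> (\<forall>z. \<exists>a b. z = a *\<^sub>R 1 + b *\<^sub>R i))"

instance real :: real_or_complex
  by standard auto

instance complex :: real_or_complex
proof
  have "z = Re z *\<^sub>R 1 + Im z *\<^sub>R \<i>" for z
    by (simp add: complex_eq_iff)
  then show "(\<forall>z::complex. \<exists>a. z = a *\<^sub>R 1) \<or>
     (\<exists>i::complex. i * i = - 1 \<and> (\<forall>z. \<exists>a b. z = a *\<^sub>R 1 + b *\<^sub>R i))"
    by (metis i_squared)
qed

(* The class banach only provides scaling by real numbers. Scaling by the field 'k is an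
   additional operation extending it; for 'k = real it is necessarily scaleR. *)
locale scalar_banach_space = vector_space scale
  for scale :: "'k::real_or_complex \<Rightarrow> 'a::banach \<Rightarrow> 'a" +
  assumes scale_of_real: "scale (of_real r) x = r *\<^sub>R x"
    and norm_scale: "norm (scale c x) = norm c * norm x"
begin

(* The dimension is the cardinality of a basis, possibly infinite; the library's dim is 0
   on infinite-dimensional spaces. *)
definition dim_gt_one :: bool where
  "dim_gt_one \<longleftrightarrow>
     (\<exists>B. local.independent B \<and> local.span B = UNIV \<and> \<not> (finite B \<and> card B \<le> 1))"

(* Elements of the type of bounded linear functions are only real-linear in general. *)
definition bounded_operators :: "('a \<Rightarrow>\<^sub>L 'a) set" where
  "bounded_operators =
     {T. \<forall>c x. blinfun_apply T (scale c x) = scale c (blinfun_apply T x)}"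

definition finite_rank :: "('a \<Rightarrow>\<^sub>L 'a) \<Rightarrow> bool" where
  "finite_rank T \<longleftrightarrow> (\<exists>F. finite F \<and> range (blinfun_apply T) \<subseteq> local.span F)"

definition scale_operator :: "'k \<Rightarrow> ('a \<Rightarrow>\<^sub>L 'a) \<Rightarrow> ('a \<Rightarrow>\<^sub>L 'a)" where
  "scale_operator c T = Blinfun (\<lambda>x. scale c (blinfun_apply T x))"

lemma bounded_linear_scale: "bounded_linear (scale c)"
proof (rule bounded_linear_intro)
  fix x y r
  show "scale c (x + y) = scale c x + scale c y"
    by (rule scale_right_distrib)
  show "scale c (r *\<^sub>R x) = r *\<^sub>R scale c x"
    by (simp add: scale_of_real[symmetric] mult.commute)
  show "norm (scale c x) \<le> norm x * norm c"
    by (simp add: norm_scale)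
qed

lemma scale_operator_apply:
  "blinfun_apply (scale_operator c T) x = scale c (blinfun_apply T x)"
  unfolding scale_operator_def
  by (subst bounded_linear_Blinfun_apply)
     (auto intro: bounded_linear_compose[OF bounded_linear_scale] blinfun.bounded_linear_right)

end

locale standard_operator_algebra = scalar_banach_space scale
  for scale :: "'k::real_or_complex \<Rightarrow> 'a::banach \<Rightarrow> 'a" +
  fixes A :: "('a \<Rightarrow>\<^sub>L 'a) set"
  assumes subset_bounded_operators: "A \<subseteq> bounded_operators"
    and zero_closed: "0 \<in> A"
    and add_closed: "\<lbrakk>S \<in> A; T \<in> A\<rbrakk> \<Longrightarrow> S + T \<in> A"
    and scale_closed: "T \<in> A \<Longrightarrow> scale_operator c T \<in> A"
    and mult_closed: "\<lbrakk>S \<in> A; T \<in> A\<rbrakk> \<Longrightarrow> S o\<^sub>L T \<in> A"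
    and finite_rank_mem: "\<lbrakk>T \<in> bounded_operators; finite_rank T\<rbrakk> \<Longrightarrow> T \<in> A"

end

theory Submission
  imports Defs
begin

text \<open>Write \<open>a \<circ> b = ab + ba\<close>. The two identities give \<open>M\<^sup>* M = id\<close> on Jordan products and
  \<open>a \<circ> M\<^sup>* (M c) = M\<^sup>* (M a) \<circ> c\<close>; testing with rank-one idempotents \<open>c\<close> yields \<open>M\<^sup>* M = id\<close>, so \<open>M\<close> is
  a bijection preserving \<open>\<circ>\<close> with inverse \<open>M\<^sup>*\<close>. Pull the addition of the ring back to an
  operation \<open>\<oplus>\<close> on the algebra. For matrix units \<open>E\<close>, \<open>F\<close>, \<open>U\<close> at the positions 11, 22, 12 and
  multiples \<open>x\<close>, \<open>y\<close> of \<open>U\<close>, distributivity gives \<open>x \<oplus> y = (E \<oplus> x) \<circ> (F \<oplus> y)\<close>, and enough of the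
  entries of the two factors can be read off from their Jordan products with \<open>E\<close>, \<open>F\<close>, \<open>U\<close> to see that
  the 12 entry of \<open>x \<oplus> y\<close> is that of \<open>x + y\<close>. Jordan multiplications by matrix units reduce all other
  entries to this one, and by Hahn--Banach the entries determine an operator.\<close>

section \<open>Sublinear functionals and the Hahn--Banach theorem\<close>

text \<open>Homogeneity is stated as an inequality, which passes easily to infima; using it also for
  \<open>1 / c\<close> recovers equality.\<close>

definition sublinear :: "('a::real_vector \<Rightarrow> real) \<Rightarrow> bool" where
  "sublinear p \<longleftrightarrow>
     (\<forall>x y. p (x + y) \<le> p x + p y) \<and> (\<forall>c x. 0 < c \<longrightarrow> p (c *\<^sub>R x) \<le> c * p x)"

lemma sublinear_add: "sublinear p \<Longrightarrow> p (x + y) \<le> p x + p y"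
  by (simp add: sublinear_def)

lemma sublinear_scaleR_le: "sublinear p \<Longrightarrow> 0 < c \<Longrightarrow> p (c *\<^sub>R x) \<le> c * p x"
  by (simp add: sublinear_def)

lemma sublinear_zero:
  assumes "sublinear p"
  shows "p 0 = 0"
  using sublinear_scaleR_le[OF assms, of 2 0] sublinear_scaleR_le[OF assms, of "1/2" 0] by simp

lemma sublinear_scaleR:
  assumes "sublinear p" "0 \<le> c"
  shows "p (c *\<^sub>R x) = c * p x"
proof (cases "c = 0")
  case True
  then show ?thesis by (simp add: sublinear_zero[OF assms(1)])
next
  case False
  with assms(2) have c: "0 < c" by simp
  have "p ((1 / c) *\<^sub>R (c *\<^sub>R x)) \<le> (1 / c) * p (c *\<^sub>R x)"
    using c by (intro sublinear_scaleR_le[OF assms(1)]) simp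
  with c have "c * p x \<le> p (c *\<^sub>R x)" by (simp add: field_simps)
  with sublinear_scaleR_le[OF assms(1) c, of x] show ?thesis by simp
qed

lemma sublinear_uminus:
  assumes "sublinear p"
  shows "- p (- x) \<le> p x"
  using sublinear_add[OF assms, of x "- x"] sublinear_zero[OF assms] by simp

lemma sublinear_norm: "sublinear norm"
  by (simp add: sublinear_def norm_triangle_ineq)

text \<open>The usual device for lowering a sublinear \<open>p\<close>: the result is again
  sublinear and below \<open>p\<close>, and its value at \<open>- y\<close> is at most
  \<open>- p y\<close> (take \<open>t = 1\<close>).\<close>

definition lower_along :: "'a::real_vector \<Rightarrow> ('a \<Rightarrow> real) \<Rightarrow> 'a \<Rightarrow> real" where
  "lower_along y p x = (INF t\<in>{0..}. p (x + t *\<^sub>R y) - t * p y)"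

lemma lower_along_le:
  assumes "sublinear p" "0 \<le> t"
  shows "lower_along y p x \<le> p (x + t *\<^sub>R y) - t * p y"
  unfolding lower_along_def
proof (rule cINF_lower)
  \<comment> \<open>A real infimum is meaningful only over a set bounded below; the bound comes from
    splitting \<open>t *\<^sub>R y\<close> as \<open>(x + t *\<^sub>R y) + - x\<close>.\<close>
  show "bdd_below ((\<lambda>t. p (x + t *\<^sub>R y) - t * p y) ` {0..})"
  proof (rule bdd_belowI2)
    fix t :: real
    assume "t \<in> {0..}"
    then have "t * p y = p ((x + t *\<^sub>R y) + - x)"
      using sublinear_scaleR[OF assms(1), of t y] by simp
    then show "- p (- x) \<le> p (x + t *\<^sub>R y) - t * p y"
      using sublinear_add[OF assms(1), of "x + t *\<^sub>R y" "- x"] by linarith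
  qed
qed (use assms in auto)

lemma lower_along_greatest:
  assumes "\<And>t. 0 \<le> t \<Longrightarrow> b \<le> p (x + t *\<^sub>R y) - t * p y"
  shows "b \<le> lower_along y p x"
  unfolding lower_along_def by (rule cINF_greatest) (use assms in auto)

lemma lower_along_le_self: "sublinear p \<Longrightarrow> lower_along y p x \<le> p x"
  using lower_along_le[of p 0 y x] by simp

text \<open>Shifts \<open>s\<close> for \<open>x1\<close> and \<open>t\<close> for \<open>x2\<close>
  combine to the shift \<open>s + t\<close> for \<open>x1 + x2\<close>; scaling by \<open>c\<close>
  turns the shift \<open>t\<close> into \<open>c * t\<close>.\<close>

lemma sublinear_lower_along:
  assumes p: "sublinear p"
  shows "sublinear (lower_along y p)"
  unfolding sublinear_def
proof (intro conjI allI impI)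
  fix x1 x2
  have "lower_along y p (x1 + x2) - (p (x2 + t *\<^sub>R y) - t * p y) \<le> lower_along y p x1"
    if t: "0 \<le> t" for t
  proof (rule lower_along_greatest)
    fix s :: real
    assume s: "0 \<le> s"
    have "lower_along y p (x1 + x2) \<le> p ((x1 + x2) + (s + t) *\<^sub>R y) - (s + t) * p y"
      using s t by (intro lower_along_le[OF p]) simp
    moreover have "(x1 + x2) + (s + t) *\<^sub>R y = (x1 + s *\<^sub>R y) + (x2 + t *\<^sub>R y)"
      by (simp add: algebra_simps)
    ultimately show "lower_along y p (x1 + x2) - (p (x2 + t *\<^sub>R y) - t * p y)
        \<le> p (x1 + s *\<^sub>R y) - s * p y"
      using sublinear_add[OF p, of "x1 + s *\<^sub>R y" "x2 + t *\<^sub>R y"]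
      by (simp add: algebra_simps)
  qed
  then have "lower_along y p (x1 + x2) - lower_along y p x1 \<le> lower_along y p x2"
    by (intro lower_along_greatest) (simp add: algebra_simps)
  then show "lower_along y p (x1 + x2) \<le> lower_along y p x1 + lower_along y p x2"
    by simp
next
  fix c :: real and x
  assume c: "0 < c"
  have "lower_along y p (c *\<^sub>R x) / c \<le> lower_along y p x"
  proof (rule lower_along_greatest)
    fix t :: real
    assume t: "0 \<le> t"
    have "lower_along y p (c *\<^sub>R x) \<le> p (c *\<^sub>R x + (c * t) *\<^sub>R y) - (c * t) * p y"
      using c t by (intro lower_along_le[OF p]) simp
    also have "c *\<^sub>R x + (c * t) *\<^sub>R y = c *\<^sub>R (x + t *\<^sub>R y)"
      by (simp add: algebra_simps)
    also have "p (c *\<^sub>R (x + t *\<^sub>R y)) = c * p (x + t *\<^sub>R y)"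
      using c by (intro sublinear_scaleR[OF p]) simp
    finally show "lower_along y p (c *\<^sub>R x) / c \<le> p (x + t *\<^sub>R y) - t * p y"
      using c by (simp add: field_simps)
  qed
  then show "lower_along y p (c *\<^sub>R x) \<le> c * lower_along y p x"
    using c by (simp add: field_simps)
qed

text \<open>For subadditivity, members \<open>p\<close> used at \<open>x\<close> and
  \<open>q\<close> used at \<open>y\<close> are both replaced by the smaller of the two, which is
  itself sublinear.\<close>

lemma sublinear_INF_chain:
  assumes "C \<noteq> {}" and sub: "\<And>p. p \<in> C \<Longrightarrow> sublinear p"
    and chain: "\<And>p q. p \<in> C \<Longrightarrow> q \<in> C \<Longrightarrow> p \<le> q \<or> q \<le> p"
    and bdd: "\<And>x. bdd_below ((\<lambda>p. p x) ` C)"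
  shows "sublinear (\<lambda>x. INF p\<in>C. p x)"
  unfolding sublinear_def
proof (intro conjI allI impI)
  fix x y
  have low: "(INF p\<in>C. p z) \<le> q z" if "q \<in> C" for q z
    using bdd that by (rule cINF_lower)
  have "(INF p\<in>C. p (x + y)) - q y \<le> (INF p\<in>C. p x)" if q: "q \<in> C" for q
  proof (rule cINF_greatest[OF \<open>C \<noteq> {}\<close>])
    fix p
    assume p: "p \<in> C"
    from chain[OF p q] obtain r where r: "r \<in> C" "r \<le> p" "r \<le> q"
      using p q by blast
    show "(INF p\<in>C. p (x + y)) - q y \<le> p x"
      using low[OF r(1), of "x + y"] sublinear_add[OF sub[OF r(1)], of x y]
        le_funD[OF r(2), of x] le_funD[OF r(3), of y]
      by linarith
  qed
  then have "(INF p\<in>C. p (x + y)) - (INF p\<in>C. p x) \<le> (INF p\<in>C. p y)"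
    by (intro cINF_greatest[OF \<open>C \<noteq> {}\<close>]) (simp add: algebra_simps)
  then show "(INF p\<in>C. p (x + y)) \<le> (INF p\<in>C. p x) + (INF p\<in>C. p y)"
    by simp
next
  fix c :: real and x
  assume c: "0 < c"
  have "(INF p\<in>C. p (c *\<^sub>R x)) / c \<le> (INF p\<in>C. p x)"
  proof (rule cINF_greatest[OF \<open>C \<noteq> {}\<close>])
    fix p
    assume p: "p \<in> C"
    have "(INF p\<in>C. p (c *\<^sub>R x)) \<le> p (c *\<^sub>R x)"
      using bdd p by (rule cINF_lower)
    also have "\<dots> \<le> c * p x"
      by (rule sublinear_scaleR_le[OF sub[OF p] c])
    finally show "(INF p\<in>C. p (c *\<^sub>R x)) / c \<le> p x"
      using c by (simp add: field_simps)
  qed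
  then show "(INF p\<in>C. p (c *\<^sub>R x)) \<le> c * (INF p\<in>C. p x)"
    using c by (simp add: field_simps)
qed

lemma ex_minimal_sublinear:
  fixes p :: "'a::real_vector \<Rightarrow> real"
  assumes p: "sublinear p"
  obtains m where "sublinear m" "m \<le> p" "\<And>q. sublinear q \<Longrightarrow> q \<le> m \<Longrightarrow> q = m"
proof -
  let ?S = "{q. sublinear q \<and> q \<le> p}"
  \<comment> \<open>The order is reversed, so that Zorn's lemma yields a minimal functional and
    chains are bounded by their pointwise infima.\<close>
  let ?R = "\<lambda>f g :: 'a \<Rightarrow> real. g \<le> f"
  have "\<exists>m\<in>?S. \<forall>q\<in>?S. ?R m q \<longrightarrow> q = m"
  proof (rule predicate_Zorn)
    show "partial_order_on ?S (relation_of ?R ?S)"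
      by (rule partial_order_on_relation_ofI) auto
  next
    fix C
    assume "C \<in> Chains (relation_of ?R ?S)"
    then have C: "\<And>q. q \<in> C \<Longrightarrow> sublinear q \<and> q \<le> p"
      and chain: "\<And>q r. q \<in> C \<Longrightarrow> r \<in> C \<Longrightarrow> q \<le> r \<or> r \<le> q"
      unfolding Chains_def relation_of_def by blast+
    show "\<exists>u\<in>?S. \<forall>q\<in>C. ?R q u"
    proof (cases "C = {}")
      case True
      then show ?thesis using p by blast
    next
      case False
      then obtain q0 where q0: "q0 \<in> C" by blast
      \<comment> \<open>The bound depends on \<open>p\<close> alone: \<open>q x\<close> \<ge>
        \<open>- q (- x)\<close> \<ge> \<open>- p (- x)\<close>.\<close>
      have bdd: "bdd_below ((\<lambda>q. q x) ` C)" for x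
      proof (rule bdd_belowI2)
        fix q
        assume "q \<in> C"
        with C have "sublinear q" "q (- x) \<le> p (- x)" by (auto dest: le_funD)
        then show "- p (- x) \<le> q x" using sublinear_uminus[of q x] by linarith
      qed
      have low: "(INF q\<in>C. q x) \<le> q x" if "q \<in> C" for q x
        using bdd that by (rule cINF_lower)
      have "sublinear (\<lambda>x. INF q\<in>C. q x)"
        by (rule sublinear_INF_chain[OF False _ chain bdd]) (simp_all add: C)
      moreover have "(\<lambda>x. INF q\<in>C. q x) \<le> p"
        using low[OF q0] C[OF q0] by (auto simp: le_fun_def intro: order_trans)
      ultimately show ?thesis
        using low by (intro bexI[of _ "\<lambda>x. INF q\<in>C. q x"] ballI CollectI conjI) (auto intro: le_funI)
    qed
  qed
  then obtain m where m: "sublinear m" "m \<le> p"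
    and min: "\<forall>q\<in>?S. q \<le> m \<longrightarrow> q = m"
    by blast
  show ?thesis
    by (rule that[OF m]) (use min m(2) in \<open>auto intro: order_trans\<close>)
qed

text \<open>Minimality forces \<open>lower_along y m = m\<close>; the shift \<open>t = 1\<close>
  then gives \<open>m x + m y\<close> \<le> \<open>m (x + y)\<close>, the converse of
  subadditivity.\<close>

lemma linear_minimal_sublinear:
  assumes m: "sublinear m" and min: "\<And>q. sublinear q \<Longrightarrow> q \<le> m \<Longrightarrow> q = m"
  shows "linear m"
proof -
  have add: "m (x + y) = m x + m y" for x y
  proof -
    have "lower_along y m = m"
      using m by (intro min sublinear_lower_along) (auto simp: le_fun_def lower_along_le_self)
    then have "m x \<le> m (x + y) - m y"
      using lower_along_le[OF m, of 1 y x] by simp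
    with sublinear_add[OF m, of x y] show ?thesis by simp
  qed
  have minus: "m (- x) = - m x" for x
    using add[of x "- x"] sublinear_zero[OF m] by simp
  have "m (c *\<^sub>R x) = c * m x" for c x
  proof (cases "0 \<le> c")
    case True
    then show ?thesis by (rule sublinear_scaleR[OF m])
  next
    case False
    then have "m ((- c) *\<^sub>R x) = - c * m x" by (intro sublinear_scaleR[OF m]) simp
    with minus[of "c *\<^sub>R x"] show ?thesis by simp
  qed
  with add show ?thesis by (intro linearI) auto
qed

text \<open>Hahn--Banach: a minimal sublinear functional below the norm is linear, and lowering the
  norm along \<open>v\<close> first forces the value at \<open>- v\<close> to be at most \<open>- norm v\<close>.\<close>

lemma ex_bounded_linear_nonzero:
  fixes v :: "'a::real_normed_vector"
  assumes "v \<noteq> 0"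
  obtains h :: "'a \<Rightarrow> real" where "bounded_linear h" "h v \<noteq> 0"
proof -
  let ?p = "lower_along v norm"
  obtain m where m: "sublinear m" "m \<le> ?p" "\<And>q. sublinear q \<Longrightarrow> q \<le> m \<Longrightarrow> q = m"
    using ex_minimal_sublinear[OF sublinear_lower_along[OF sublinear_norm, of v]] by blast
  interpret linear m using linear_minimal_sublinear[OF m(1,3)] .
  have le: "m x \<le> norm x" for x
    using le_funD[OF m(2), of x] lower_along_le_self[OF sublinear_norm, of v x] by linarith
  have "\<bar>m x\<bar> \<le> norm x" for x
    using le[of x] le[of "- x"] by (simp add: neg)
  then have "bounded_linear m"
    by (intro bounded_linear_intro[of _ 1]) (auto simp: add scale)
  moreover have "m (- v) \<le> - norm v"
    using le_funD[OF m(2), of "- v"] lower_along_le[OF sublinear_norm, of 1 v "- v"] by simp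
  then have "m v \<noteq> 0" using zero_less_norm_iff[of v] assms by (auto simp: neg)
  ultimately show ?thesis using that by blast
qed

section \<open>Scalar-valued functionals and rank-one operators\<close>

context scalar_banach_space
begin

definition functional :: "('a \<Rightarrow> 'k) \<Rightarrow> bool" where
  "functional f \<longleftrightarrow> bounded_linear f \<and> (\<forall>c x. f (scale c x) = c * f x)"

lemma functional_scale: "functional f \<Longrightarrow> f (scale c x) = c * f x"
  and functional_add: "functional f \<Longrightarrow> f (x + y) = f x + f y"
  and functional_diff: "functional f \<Longrightarrow> f (x - y) = f x - f y"
  and functional_zero: "functional f \<Longrightarrow> f 0 = 0"
  by (auto simp: functional_def bounded_linear.linear linear_add linear_diff linear_0)

lemmas functional_simps =
  functional_scale functional_add functional_diff functional_zero

lemma functional_diff_fun: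
  "functional f \<Longrightarrow> functional g \<Longrightarrow> functional (\<lambda>x. f x - g x)"
  by (auto simp: functional_def bounded_linear_sub algebra_simps)

lemma functional_cmult: "functional f \<Longrightarrow> functional (\<lambda>x. c * f x)"
  by (auto simp: functional_def bounded_linear_mult_right algebra_simps
      intro: bounded_linear_compose[OF bounded_linear_mult_right])

lemma functional_diff_cmult:
  "functional f \<Longrightarrow> functional g \<Longrightarrow> functional (\<lambda>x. f x - c * g x)"
  by (intro functional_diff_fun functional_cmult)

lemma ex_functional_nonzero:
  assumes "v \<noteq> 0"
  obtains f where "functional f" "f v \<noteq> 0"
proof -
  obtain h :: "'a \<Rightarrow> real" where h: "bounded_linear h" "h v \<noteq> 0"
    using ex_bounded_linear_nonzero[OF assms] by blast
  interpret h: bounded_linear h by (rule h(1))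
  have bl: "bounded_linear (\<lambda>x. of_real (h x) :: 'k)"
    by (rule bounded_linear_compose[OF bounded_linear_of_real h(1)])
  from real_or_complex show thesis
  proof
    assume R: "\<forall>z :: 'k. \<exists>a. z = a *\<^sub>R 1"
    have "functional (\<lambda>x. of_real (h x))"
      unfolding functional_def
    proof (intro conjI allI bl)
      fix c :: 'k and x
      obtain a where "c = of_real a" using R by (auto simp: of_real_def)
      then show "of_real (h (scale c x)) = c * of_real (h x)"
        by (simp add: scale_of_real h.scale)
    qed
    then show thesis by (rule that) (simp add: h(2))
  next
    assume "\<exists>i :: 'k. i * i = - 1 \<and> (\<forall>z. \<exists>a b. z = a *\<^sub>R 1 + b *\<^sub>R i)"
    then obtain i :: 'k where i: "i * i = - 1" and C: "\<And>z. \<exists>a b. z = a *\<^sub>R 1 + b *\<^sub>R i"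
      by blast
    \<comment> \<open>The classical complexification of a real functional;
      \<open>i * i = - 1\<close> makes it homogeneous under \<open>i\<close>.\<close>
    define f where "f x = of_real (h x) - i * of_real (h (scale i x))" for x
    have "bounded_linear f"
      unfolding f_def
      by (intro bounded_linear_sub bl bounded_linear_compose[OF bounded_linear_mult_right]
          bounded_linear_compose[OF bl bounded_linear_scale])
    moreover have "f (scale c x) = c * f x" for c x
    proof -
      obtain a b where c: "c = of_real a + of_real b * i"
        using C[of c] by (metis mult_scaleR_left mult_1 of_real_def)
      have ii: "i * (i * z) = - z" for z
        by (simp add: i flip: mult.assoc)
      have cx: "scale c x = a *\<^sub>R x + b *\<^sub>R scale i x"
        by (simp add: c scale_left_distrib scale_of_real flip: scale_scale)
      have "scale i (scale c x) = scale (of_real a * i + of_real b * (i * i)) x"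
        by (simp add: c algebra_simps)
      also have "\<dots> = a *\<^sub>R scale i x - b *\<^sub>R x"
        by (simp add: i scale_left_diff_distrib scale_of_real flip: scale_scale)
      finally have icx: "scale i (scale c x) = a *\<^sub>R scale i x - b *\<^sub>R x" .
      show ?thesis
        unfolding f_def icx unfolding cx
        by (simp add: h.add h.diff h.scale c algebra_simps ii)
    qed
    ultimately have "functional f" by (simp add: functional_def)
    moreover have "f v \<noteq> 0"
    proof
      assume "f v = 0"
      then have *: "of_real (h v) = i * of_real (h (scale i v))" by (simp add: f_def)
      \<comment> \<open>Squaring removes \<open>i\<close> and leaves an equation between reals in
        which a square equals minus a square.\<close>
      have "of_real (h v * h v) = (i * i) * of_real (h (scale i v) * h (scale i v))"
        unfolding of_real_mult by (subst *, subst *) (simp add: algebra_simps)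
      also have "\<dots> = of_real (- (h (scale i v) * h (scale i v)))" by (simp add: i)
      finally have "h v * h v = - (h (scale i v) * h (scale i v))"
        unfolding of_real_eq_iff .
      then have "h v * h v \<le> 0" by simp
      with h(2) show False by (auto simp: mult_le_0_iff)
    qed
    ultimately show thesis using that by blast
  qed
qed

lemma ex_functional_one:
  assumes "v \<noteq> 0"
  obtains f where "functional f" "f v = 1"
proof -
  obtain f where f: "functional f" "f v \<noteq> 0" using ex_functional_nonzero[OF assms] by blast
  show thesis by (rule that[OF functional_cmult[OF f(1), of "inverse (f v)"]]) (simp add: f(2))
qed

text \<open>The tensor of \<open>x\<close> and \<open>f\<close>; for a functional \<open>f\<close>
  with \<open>f x = 1\<close> it is an idempotent.\<close>

definition rank_one :: "'a \<Rightarrow> ('a \<Rightarrow> 'k) \<Rightarrow> ('a \<Rightarrow>\<^sub>L 'a)" where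
  "rank_one x f = Blinfun (\<lambda>v. scale (f v) x)"

lemma rank_one_apply:
  assumes "functional f"
  shows "blinfun_apply (rank_one x f) v = scale (f v) x"
proof -
  have f: "bounded_linear f" using assms by (simp add: functional_def)
  then obtain K where K: "\<And>v. norm (f v) \<le> norm v * K"
    using bounded_linear.bounded by blast
  have "bounded_linear (\<lambda>v. scale (f v) x)"
  proof (rule bounded_linear_intro)
    fix r v w
    show "scale (f (v + w)) x = scale (f v) x + scale (f w) x"
      by (simp add: functional_add[OF assms] scale_left_distrib)
    show "scale (f (r *\<^sub>R v)) x = r *\<^sub>R scale (f v) x"
      by (simp add: functional_scale[OF assms] flip: scale_of_real scale_scale)
    show "norm (scale (f v) x) \<le> norm v * (K * norm x)"
      using mult_right_mono[OF K[of v] norm_ge_zero[of x]] by (simp add: norm_scale mult_ac)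
  qed
  then show ?thesis unfolding rank_one_def by (simp add: bounded_linear_Blinfun_apply)
qed

lemma rank_one_bounded_operators: "functional f \<Longrightarrow> rank_one x f \<in> bounded_operators"
  by (simp add: bounded_operators_def rank_one_apply functional_scale)

lemma finite_rank_rank_one:
  assumes "functional f"
  shows "finite_rank (rank_one x f)"
  unfolding finite_rank_def
  by (rule exI[of _ "{x}"]) (auto simp: rank_one_apply[OF assms] span_base span_scale)

end

section \<open>The Jordan product of operators\<close>

definition jordan :: "('a::real_normed_vector \<Rightarrow>\<^sub>L 'a) \<Rightarrow> ('a \<Rightarrow>\<^sub>L 'a) \<Rightarrow> ('a \<Rightarrow>\<^sub>L 'a)" where
  "jordan a b = (a o\<^sub>L b) + (b o\<^sub>L a)"

lemma jordan_apply: "blinfun_apply (jordan a b) v = a (b v) + b (a v)"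
  by (simp add: jordan_def blinfun.add_left)

lemma jordan_commute: "jordan a b = jordan b a"
  by (simp add: jordan_def add.commute)

lemma jordan_add_right: "jordan a (b + c) = jordan a b + jordan a c"
  by (rule blinfun_eqI) (simp add: jordan_apply blinfun.add_left blinfun.add_right)

lemma jordan_diff_right: "jordan a (b - c) = jordan a b - jordan a c"
  by (rule blinfun_eqI) (simp add: jordan_apply blinfun.diff_left blinfun.diff_right)

lemma jordan_0_left: "jordan 0 b = 0"
  by (rule blinfun_eqI) (simp add: jordan_apply)

context scalar_banach_space
begin

text \<open>Evaluating at \<open>v\<close> gives \<open>f (d v)\<close> times \<open>v\<close> plus
  \<open>d v\<close> equal to 0. Applying \<open>f\<close> shows \<open>2 * f (d v) = 0\<close>,
  whence \<open>d v = 0\<close>.\<close>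

lemma jordan_rank_one_faithful:
  assumes "\<And>v f. functional f \<Longrightarrow> f v = 1 \<Longrightarrow> jordan (rank_one v f) d = 0"
  shows "d = 0"
proof (rule blinfun_eqI)
  fix v
  show "blinfun_apply d v = blinfun_apply 0 v"
  proof (cases "v = 0")
    case False
    then obtain f where f: "functional f" "f v = 1" using ex_functional_one by blast
    have "blinfun_apply (jordan (rank_one v f) d) v = 0"
      using assms[OF f] by simp
    then have *: "scale (f (d v)) v + d v = 0"
      by (simp add: jordan_apply rank_one_apply f)
    then have "f (scale (f (d v)) v + d v) = 0" by (simp add: functional_zero f)
    then have "f (d v) = 0" by (simp add: functional_simps f flip: mult_2)
    with * show ?thesis by simp
  qed (simp add: blinfun.zero_right)
qed

end

context standard_operator_algebra
begin

lemma rank_one_mem: "functional f \<Longrightarrow> rank_one x f \<in> A"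
  by (intro finite_rank_mem rank_one_bounded_operators finite_rank_rank_one)

lemma jordan_closed: "a \<in> A \<Longrightarrow> b \<in> A \<Longrightarrow> jordan a b \<in> A"
  by (simp add: jordan_def add_closed mult_closed)

lemma apply_scale: "a \<in> A \<Longrightarrow> blinfun_apply a (scale c x) = scale c (a x)"
  using subset_bounded_operators by (auto simp: bounded_operators_def)

end

section \<open>Operations over which the Jordan product distributes\<close>

text \<open>The intended operation is \<open>Mstar (M a + M b)\<close>, the addition of the ring
  pulled back to \<open>A\<close>.\<close>

locale jordan_distributive_operation = standard_operator_algebra scale A
  for scale :: "'k::real_or_complex \<Rightarrow> 'a::banach \<Rightarrow> 'a" and A +
  fixes oplus :: "('a \<Rightarrow>\<^sub>L 'a) \<Rightarrow> ('a \<Rightarrow>\<^sub>L 'a) \<Rightarrow> ('a \<Rightarrow>\<^sub>L 'a)" (infixl "\<oplus>" 65)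
  assumes dim: dim_gt_one
    and oplus_closed: "\<lbrakk>a \<in> A; b \<in> A\<rbrakk> \<Longrightarrow> a \<oplus> b \<in> A"
    and oplus_0_right: "a \<in> A \<Longrightarrow> a \<oplus> 0 = a"
    and oplus_0_left: "a \<in> A \<Longrightarrow> 0 \<oplus> a = a"
    and jordan_oplus: "\<lbrakk>c \<in> A; a \<in> A; b \<in> A\<rbrakk> \<Longrightarrow> jordan c (a \<oplus> b) = jordan c a \<oplus> jordan c b"
begin

text \<open>If \<open>f1\<close> had trivial kernel, \<open>e1\<close> would span the space. A
  functional \<open>g\<close> with \<open>g e2 = 1\<close> is corrected by a multiple of
  \<open>f1\<close> to vanish at \<open>e1\<close>.\<close>

lemma ex_complementary:
  assumes "functional f1" "f1 e1 = 1"
  obtains e2 f2 where "functional f2" "f1 e2 = 0" "f2 e1 = 0" "f2 e2 = 1"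
proof -
  have "\<exists>e2. e2 \<noteq> 0 \<and> f1 e2 = 0"
  proof (rule ccontr)
    assume "\<not> ?thesis"
    then have inj: "x = 0" if "f1 x = 0" for x using that by blast
    have "x = scale (f1 x) e1" for x
      using inj[of "x - scale (f1 x) e1"] by (simp add: functional_simps assms)
    then have UN: "span {e1} = UNIV"
      by (metis UNIV_eq_I insertI1 span_base span_scale)
    obtain B where B: "independent B" "\<not> (finite B \<and> card B \<le> 1)"
      using dim by (auto simp: dim_gt_one_def)
    have "finite B \<and> card B \<le> card {e1}"
      using B(1) UN by (intro independent_span_bound) auto
    with B(2) show False by simp
  qed
  then obtain e2 where e2: "e2 \<noteq> 0" "f1 e2 = 0" by blast
  then obtain g where g: "functional g" "g e2 = 1" using ex_functional_one by blast
  show thesis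
    by (rule that[OF functional_diff_cmult[OF g(1) assms(1), of "g e1"] e2(2)])
      (simp_all add: assms e2 g)
qed

text \<open>The factors \<open>p\<close> and \<open>q\<close> play the roles of \<open>E + x\<close>
  and \<open>F + y\<close>. They are accessible only through Jordan products, which determine enough
  of them to evaluate \<open>jordan p q\<close>.\<close>

lemma oplus_offdiagonal_units:
  assumes f: "functional f1" "functional f2"
    and e: "f1 e1 = 1" "f1 e2 = 0" "f2 e1 = 0" "f2 e2 = 1"
  shows "f1 ((rank_one (scale \<nu> e1) f2 \<oplus> rank_one (scale \<mu> e1) f2) e2) = \<nu> + \<mu>"
proof -
  note simps = jordan_apply rank_one_apply f functional_simps e
  define E F U x y where "E = rank_one e1 f1" and "F = rank_one e2 f2" and "U = rank_one e1 f2"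
    and "x = rank_one (scale \<nu> e1) f2" and "y = rank_one (scale \<mu> e1) f2"
  note defs = E_def F_def U_def x_def y_def
  have A: "E \<in> A" "F \<in> A" "U \<in> A" "x \<in> A" "y \<in> A"
    by (simp_all add: defs rank_one_mem f)
  define p q where "p = E \<oplus> x" and "q = F \<oplus> y"
  have pA: "p \<in> A" and qA: "q \<in> A" by (simp_all add: p_def q_def oplus_closed A)
  have "jordan F E = 0" "jordan E F = 0" "jordan F x = x" "jordan E y = y"
    "jordan U x = 0" "jordan U y = 0" "jordan U E = U" "jordan U F = U"
    "jordan x F = x" "jordan x y = 0"
    by (auto intro!: blinfun_eqI simp: defs simps mult_ac)
  note table = this
  \<comment> \<open>Each of these multiplications sends one summand to 0, where the value of
    \<oplus> is known.\<close>
  have Fp: "jordan F p = x" and Up: "jordan U p = U"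
    and Eq: "jordan E q = y" and Uq: "jordan U q = U"
    by (simp_all add: p_def q_def jordan_oplus A table oplus_0_left oplus_0_right)

  have pe2: "blinfun_apply p e2 = scale \<nu> e1"
  proof -
    have "blinfun_apply (jordan F p) e2 = x e2" by (simp add: Fp)
    then have *: "scale (f2 (p e2)) e2 + p e2 = scale \<nu> e1"
      by (simp add: F_def x_def simps)
    then have "f2 (scale (f2 (p e2)) e2 + p e2) = f2 (scale \<nu> e1)" by simp
    then have "f2 (p e2) = 0" by (simp add: simps flip: mult_2)
    with * show ?thesis by simp
  qed
  have f2p: "f2 (p v) = 0" for v
  proof -
    have "f2 (jordan F p v) = f2 (x v)" by (simp add: Fp)
    then show ?thesis by (simp add: F_def x_def simps apply_scale pA pe2)
  qed
  have pe1: "blinfun_apply p e1 = e1"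
  proof -
    have "blinfun_apply (jordan U p) e2 = U e2" by (simp add: Up)
    then show ?thesis by (simp add: U_def simps f2p)
  qed
  have qe1: "blinfun_apply q e1 = 0"
  proof -
    have "blinfun_apply (jordan E q) e1 = y e1" by (simp add: Eq)
    then have *: "scale (f1 (q e1)) e1 + q e1 = 0"
      by (simp add: E_def y_def simps)
    then have "f1 (scale (f1 (q e1)) e1 + q e1) = 0" by (simp add: simps)
    then have "f1 (q e1) = 0" by (simp add: simps flip: mult_2)
    with * show ?thesis by simp
  qed
  have f1q: "f1 (q v) = \<mu> * f2 v" for v
  proof -
    have "f1 (jordan E q v) = f1 (y v)" by (simp add: Eq)
    then show ?thesis by (simp add: E_def y_def simps apply_scale qA qe1 mult_ac)
  qed
  have f2q: "f2 (q v) = f2 v" for v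
  proof -
    have "f1 (jordan U q v) = f1 (U v)" by (simp add: Uq)
    then show ?thesis by (simp add: U_def simps apply_scale qA qe1)
  qed
  \<comment> \<open>The component of \<open>q e2\<close> in the common kernel of \<open>f1\<close>
    and \<open>f2\<close>. It is not shown to vanish; it suffices that \<open>p\<close> kills
    it.\<close>
  define z where "z = blinfun_apply q e2 - scale \<mu> e1 - e2"
  have fz: "f1 z = 0" "f2 z = 0" by (simp_all add: z_def simps f1q f2q)
  have pz: "blinfun_apply p z = 0"
  proof (cases "z = 0")
    case False
    then obtain g where g: "functional g" "g z = 1" using ex_functional_one by blast
    \<comment> \<open>Correcting \<open>g\<close> makes it vanish at \<open>e1\<close> and
      \<open>e2\<close> and keeps the value 1 at \<open>z\<close>.\<close>
    define f3 where "f3 v = g v - g e1 * f1 v - g e2 * f2 v" for v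
    have f3: "functional f3"
      unfolding f3_def using g(1) f by (intro functional_diff_cmult)
    have f3e: "f3 e1 = 0" "f3 e2 = 0" "f3 z = 1" by (simp_all add: f3_def e fz g)
    define G where "G = rank_one z f3"
    have G: "G \<in> A" by (simp add: G_def rank_one_mem f3)
    \<comment> \<open>\<open>G\<close> annihilates both summands of \<open>p\<close>, hence
      \<open>p\<close> itself; evaluating at \<open>z\<close> and applying \<open>f3\<close> then
      gives \<open>p z = 0\<close>.\<close>
    have "jordan G E = 0" "jordan G x = 0"
      by (auto intro!: blinfun_eqI simp: G_def defs simps f3 functional_simps f3e fz)
    then have "jordan G p = 0" by (simp add: p_def jordan_oplus A G oplus_0_left zero_closed)
    then have "blinfun_apply (jordan G p) z = 0" by simp
    then have *: "scale (f3 (p z)) z + p z = 0"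
      by (simp add: G_def jordan_apply rank_one_apply f3 f3e)
    then have "f3 (scale (f3 (p z)) z + p z) = 0" by (simp add: functional_zero f3)
    then have "f3 (p z) = 0" by (simp add: functional_simps f3 f3e flip: mult_2)
    with * show ?thesis by simp
  qed (simp add: blinfun.zero_right)
  have qe2: "blinfun_apply q e2 = z + scale \<mu> e1 + e2" by (simp add: z_def)
  \<comment> \<open>Distributing \<open>p\<close> over \<open>q\<close> gives
    \<open>jordan p F\<close> \<oplus> \<open>jordan p y\<close>, and these terms are
    \<open>x\<close> and \<open>y\<close>.\<close>
  have "x \<oplus> y = jordan p q"
  proof -
    have "jordan p F = x" by (simp add: jordan_commute[of p] Fp)
    moreover have "jordan p y = y"
    proof -
      have "jordan y p = jordan y E \<oplus> jordan y x" unfolding p_def by (simp add: jordan_oplus A)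
      also have "jordan y E = y" by (simp add: jordan_commute[of y] table)
      also have "jordan y x = 0" by (simp add: jordan_commute[of y] table)
      finally show ?thesis by (simp add: jordan_commute[of p] oplus_0_right A)
    qed
    ultimately show ?thesis unfolding q_def by (simp add: jordan_oplus A pA)
  qed
  \<comment> \<open>Here \<open>p (q e2)\<close> is \<mu> + \<nu> times \<open>e1\<close>, while
    \<open>q (p e2)\<close> is a multiple of \<open>q e1 = 0\<close>.\<close>
  then have "f1 ((x \<oplus> y) e2) = \<nu> + \<mu>"
    by (simp add: simps f1q pe2 apply_scale qA qe1)
       (simp add: qe2 blinfun.add_right pz apply_scale pA pe1 pe2 simps)
  then show ?thesis by (simp add: x_def y_def)
qed

lemma oplus_offdiagonal_entry:
  assumes f: "functional f1" "functional f2"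
    and e: "f1 e1 = 1" "f1 e2 = 0" "f2 e1 = 0" "f2 e2 = 1"
    and a: "a \<in> A" and b: "b \<in> A"
  shows "f1 ((a \<oplus> b) e2) = f1 (a e2) + f1 (b e2)"
proof -
  note simps = jordan_apply rank_one_apply f functional_simps e
  define E F U V where "E = rank_one e1 f1" and "F = rank_one e2 f2" and "U = rank_one e1 f2"
    and "V = rank_one e2 f1"
  note defs = E_def F_def U_def V_def
  have A: "E \<in> A" "F \<in> A" "U \<in> A" "V \<in> A" by (simp_all add: defs rank_one_mem f)
  \<comment> \<open>Multiplying by \<open>F\<close> and \<open>E\<close> keeps the 12 and 21
    entries. Then \<open>V\<close> turns the 12 entry into a multiple of \<open>E + F\<close> and
    kills the 21 entry, and \<open>U\<close> returns twice the 12 entry at position 12.\<close>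
  define T where "T c = jordan U (jordan V (jordan E (jordan F c)))" for c
  have T: "T c = rank_one (scale (f1 (c e2) + f1 (c e2)) e1) f2" if c: "c \<in> A" for c
  proof -
    have EF: "blinfun_apply (jordan E (jordan F c)) v =
        scale (f1 (c e2) * f2 v) e1 + scale (f2 (c e1) * f1 v) e2" for v
      by (simp add: defs simps apply_scale c blinfun.add_right scale_right_distrib mult.commute)
    have V: "blinfun_apply (jordan V (jordan E (jordan F c))) v =
        scale (f1 (c e2) * f1 v) e1 + scale (f1 (c e2) * f2 v) e2" for v
      unfolding jordan_apply[of V] EF by (simp add: V_def simps mult.commute add.commute)
    show ?thesis
      unfolding T_def
    proof (rule blinfun_eqI)
      fix v
      show "blinfun_apply (jordan U (jordan V (jordan E (jordan F c)))) v =
          rank_one (scale (f1 (c e2) + f1 (c e2)) e1) f2 v"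
        unfolding jordan_apply[of U] V
        by (simp add: U_def simps mult.commute,
            simp add: mult.left_commute flip: scale_left_distrib)
    qed
  qed
  have "T (a \<oplus> b) = T a \<oplus> T b"
    by (simp add: T_def jordan_oplus jordan_closed A a b)
  then have "f1 (T (a \<oplus> b) e2) = (f1 (a e2) + f1 (a e2)) + (f1 (b e2) + f1 (b e2))"
    using oplus_offdiagonal_units[OF f e] by (simp add: T a b)
  moreover have "f1 (T (a \<oplus> b) e2) = f1 ((a \<oplus> b) e2) + f1 ((a \<oplus> b) e2)"
    by (simp add: T oplus_closed a b simps)
  ultimately have "2 * f1 ((a \<oplus> b) e2) = 2 * (f1 (a e2) + f1 (b e2))"
    by simp
  then show ?thesis by (simp only: mult_cancel_left) simp
qed

text \<open>Outside the trivial cases, \<open>g\<close> and \<open>v\<close> extend to a dual system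
  in which this is the 12 entry: subtracting a multiple of \<open>v\<close> from \<open>e\<close>
  makes \<open>f\<close> vanish there and keeps \<open>g\<close> equal to 1.\<close>

lemma oplus_entry_orthogonal:
  assumes g: "functional g" "g v = 0" and a: "a \<in> A" and b: "b \<in> A"
  shows "g ((a \<oplus> b) v) = g (a v) + g (b v)"
proof (cases "v = 0 \<or> (\<forall>w. g w = 0)")
  case True
  then show ?thesis by (auto simp: blinfun.zero_right functional_zero g)
next
  case False
  then obtain f where f: "functional f" "f v = 1" using ex_functional_one by blast
  from False obtain w where w: "g w \<noteq> 0" by blast
  define e where "e = scale (inverse (g w)) w"
  have "g e = 1" by (simp add: e_def functional_simps g w)
  then show ?thesis
    by (intro oplus_offdiagonal_entry[of g f "e - scale (f e) v" v])
       (simp_all add: a b g f functional_simps)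
qed

text \<open>The error \<open>d = a \<oplus> b - (a + b)\<close> has vanishing off-diagonal entries in every basis, so its
  diagonal entries agree; those of \<open>jordan U d\<close> for a matrix unit \<open>U\<close> show that they also
  sum to zero.\<close>

lemma oplus_entry_diagonal:
  assumes f: "functional f1" "f1 e1 = 1" and a: "a \<in> A" and b: "b \<in> A"
  shows "f1 ((a \<oplus> b) e1) = f1 (a e1) + f1 (b e1)"
proof -
  obtain e2 f2 where f2: "functional f2" and e: "f1 e2 = 0" "f2 e1 = 0" "f2 e2 = 1"
    using ex_complementary[OF f] by blast
  note simps = functional_simps f f2 e
  define d where "d = a \<oplus> b - (a + b)"
  have off: "g (d v) = 0" if "functional g" "g v = 0" for g v
    using oplus_entry_orthogonal[OF that a b]
    by (simp add: d_def blinfun.diff_left blinfun.add_left functional_simps that)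
  \<comment> \<open>The functional \<open>f1 - f2\<close> vanishes at \<open>e1 + e2\<close>, so
    this too is an off-diagonal entry.\<close>
  have "f1 (d (e1 + e2)) - f2 (d (e1 + e2)) = 0"
    by (rule off[OF functional_diff_fun]) (simp_all add: simps)
  then have eq: "f1 (d e1) = f2 (d e2)"
    using off[of f1 e2] off[of f2 e1] by (simp add: blinfun.add_right simps)
  define U where "U = rank_one e1 f2"
  have U: "U \<in> A" by (simp add: U_def rank_one_mem f2)
  have "jordan U a \<oplus> jordan U b = jordan U a + jordan U b + jordan U d"
    by (simp add: d_def jordan_diff_right jordan_add_right jordan_oplus U a b)
  moreover have "f1 ((jordan U a \<oplus> jordan U b) e2) = f1 (jordan U a e2) + f1 (jordan U b e2)"
    by (intro oplus_entry_orthogonal jordan_closed U a b) (simp_all add: simps)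
  ultimately have "f1 (jordan U d e2) = 0"
    by (simp add: blinfun.add_left simps)
  then have "f2 (d e2) + f1 (d e1) = 0"
    by (simp add: U_def jordan_apply rank_one_apply simps)
  with eq have "f1 (d e1) = 0" by (simp flip: mult_2)
  then show ?thesis by (simp add: d_def blinfun.diff_left blinfun.add_left simps)
qed

lemma oplus_eq_plus:
  assumes "a \<in> A" "b \<in> A"
  shows "a \<oplus> b = a + b"
proof -
  have entry: "g ((a \<oplus> b) v) = g (a v) + g (b v)" if g: "functional g" for g v
  proof (cases "g v = 0")
    case True
    then show ?thesis by (rule oplus_entry_orthogonal[OF g _ assms])
  next
    case False
    \<comment> \<open>Normalising \<open>g\<close> to take the value 1 at \<open>v\<close> makes
      this a diagonal entry.\<close>
    have "inverse (g v) * g ((a \<oplus> b) v) = inverse (g v) * g (a v) + inverse (g v) * g (b v)"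
      by (rule oplus_entry_diagonal[OF functional_cmult[OF g] _ assms]) (simp add: False)
    with False show ?thesis by (simp flip: distrib_left)
  qed
  show ?thesis
  proof (rule blinfun_eqI, rule ccontr)
    fix v
    assume "blinfun_apply (a \<oplus> b) v \<noteq> blinfun_apply (a + b) v"
    then have "(a \<oplus> b) v - (a + b) v \<noteq> 0" by simp
    then obtain g where g: "functional g" "g ((a \<oplus> b) v - (a + b) v) = 1"
      using ex_functional_one by blast
    then show False
      by (simp add: functional_simps blinfun.add_left entry[OF g(1)])
  qed
qed

end

section \<open>Inverting \<open>M\<close> and transporting the addition\<close>

theorem corollary22:
  fixes scale :: "'k::real_or_complex \<Rightarrow> 'a::banach \<Rightarrow> 'a"
    and A :: "('a \<Rightarrow>\<^sub>L 'a) set"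
    and M :: "('a \<Rightarrow>\<^sub>L 'a) \<Rightarrow> 'r::ring"
    and Mstar :: "'r \<Rightarrow> ('a \<Rightarrow>\<^sub>L 'a)"
  assumes "standard_operator_algebra scale A"
    and "scalar_banach_space.dim_gt_one scale"
    and "M ` A = UNIV"
    and "range Mstar = A"
    and "\<And>a x. a \<in> A \<Longrightarrow>
           M ((a o\<^sub>L Mstar x) + (Mstar x o\<^sub>L a)) = M a * x + x * M a"
    and "\<And>a x. a \<in> A \<Longrightarrow>
           Mstar (M a * x + x * M a) = (a o\<^sub>L Mstar x) + (Mstar x o\<^sub>L a)"
  shows "(\<forall>a\<in>A. \<forall>b\<in>A. M (a + b) = M a + M b) \<and>
         (\<forall>x y. Mstar (x + y) = Mstar x + Mstar y)"
proof -
  interpret standard_operator_algebra scale A by (rule assms(1))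
  have MJ: "M (jordan a (Mstar x)) = M a * x + x * M a" if "a \<in> A" for a x
    using assms(5)[OF that] by (simp add: jordan_def)
  have MsJ: "Mstar (M a * x + x * M a) = jordan a (Mstar x)" if "a \<in> A" for a x
    using assms(6)[OF that] by (simp add: jordan_def)
  have Ms_mem: "Mstar x \<in> A" for x using assms(4) by blast
  have fixed: "Mstar (M (jordan a c)) = jordan a c" if "a \<in> A" "c \<in> A" for a c
  proof -
    from that(2) obtain x where "c = Mstar x" using assms(4) by blast
    then show ?thesis by (simp add: MJ MsJ that(1))
  qed
  \<comment> \<open>Both sides are the image under \<open>Mstar\<close> of the symmetric expression
    \<open>M a * M c + M c * M a\<close>.\<close>
  have swap: "jordan a (Mstar (M c)) = jordan (Mstar (M a)) c" if "a \<in> A" "c \<in> A" for a c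
  proof -
    have "jordan a (Mstar (M c)) = Mstar (M a * M c + M c * M a)" by (simp add: MsJ that)
    also have "\<dots> = jordan c (Mstar (M a))"
      using MsJ[OF that(2), of "M a"] by (simp add: add.commute)
    finally show ?thesis by (simp add: jordan_commute)
  qed
  have MsM: "Mstar (M a) = a" if a: "a \<in> A" for a
  proof -
    have "Mstar (M a) - a = 0"
    proof (rule jordan_rank_one_faithful)
      fix v f
      assume f: "functional f" "f v = 1"
      \<comment> \<open>The factor 1/2 exhibits the idempotent as a Jordan product, so that
        \<open>fixed\<close> applies to it.\<close>
      have E: "rank_one v f = jordan (rank_one v f) (rank_one (scale (1/2) v) f)"
        by (rule blinfun_eqI)
           (simp add: jordan_apply rank_one_apply f functional_scale,
            simp flip: scale_left_distrib)
      have "Mstar (M (rank_one v f)) = rank_one v f"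
        using fixed[OF rank_one_mem[OF f(1)] rank_one_mem[OF f(1)], of v "scale (1/2) v"]
        by (simp only: E[symmetric])
      then show "jordan (rank_one v f) (Mstar (M a) - a) = 0"
        using swap[OF rank_one_mem[OF f(1)] a, of v] by (simp add: jordan_diff_right)
    qed
    then show ?thesis by simp
  qed
  have MMs: "M (Mstar x) = x" for x
  proof -
    from assms(3) obtain a where "a \<in> A" "x = M a" by blast
    then show ?thesis by (simp add: MsM)
  qed
  have M0: "M 0 = 0"
    using MJ[OF zero_closed, of 0] by (simp add: jordan_0_left)
  have M_jordan: "M (jordan a c) = M a * M c + M c * M a" if "a \<in> A" "c \<in> A" for a c
    using MJ[OF that(1), of "M c"] by (simp add: MsM that)
  \<comment> \<open>Distributivity holds because \<open>M\<close> carries Jordan products to those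
    of the ring, where multiplication distributes over addition.\<close>
  interpret jordan_distributive_operation scale A "\<lambda>a b. Mstar (M a + M b)"
  proof
    fix a b c
    assume A: "c \<in> A" "a \<in> A" "b \<in> A"
    have "jordan c (Mstar (M a + M b)) = Mstar (M c * (M a + M b) + (M a + M b) * M c)"
      by (simp add: MsJ A)
    also have "\<dots> = Mstar (M (jordan c a) + M (jordan c b))"
      by (simp add: M_jordan A algebra_simps)
    finally show "jordan c (Mstar (M a + M b)) = Mstar (M (jordan c a) + M (jordan c b))" .
  qed (simp_all add: assms(2) Ms_mem M0 MsM)
  have add: "M (a + b) = M a + M b" if "a \<in> A" "b \<in> A" for a b
    using oplus_eq_plus[OF that] MMs by metis
  have "Mstar (x + y) = Mstar x + Mstar y" for x y
    using oplus_eq_plus[OF Ms_mem Ms_mem, of x y] by (simp add: MMs)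
  with add show ?thesis by blast
qed

end
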